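(* Let $(\mathcal A,\mathcal C,E,\alpha^* )$ be a covariant positive flow with phase space $X$ and (finite) spectral potential $\lambda$. Suppose that for certain functions $\varphi,f\in C(X)$ the derivative $$\left.\frac{d\lambda(\varphi+tf)}{dt}\right|_{t=0}=a$$ exists, and that $\nu$ is a $\varphi$-sensitive state. Then the sequence $\{f\circ\alpha^n\}$ satisfies the law of large numbers with respect to the measures $P_n=\nu(\,\cdot\,E_\varphi^n)/\nu(E_\varphi^n)$, namely $$\lim_{n\to\infty}P_n\bigl\{x\in X\bigm| |\delta_{x,n}(f)-a|>\varepsilon\bigr\}=0\quad\text{for all }\varepsilon>0 .$$ If, in addition, $\nu$ is a right eigen-state for $E_\varphi$, then the strong law of large numbers holds: $$\lim_{n\to\infty}\delta_{x,n}(f)=a\quad\text{for }\nu\text{-almost all }x\in X .$$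
   Context: All algebras are real and associative. A cone in a real vector space is a convex subset $K$ with $tK\subset K$ for $t\ge0$ and such that $v,-v\in K$ imply $v=0$; $u\le v$ means $v-u\in K$. A positive algebra is a real normed algebra $\mathcal A$ ($\|ab\|\le\|a\|\|b\|$) with unit $I$, $\|I\|=1$, and a cone $\mathcal A_+$ closed under products and containing $I$, whose norm is monotone: $\|u\|\le\|u+v\|$ for $u,v\in\mathcal A_+$. A phase subalgebra $\mathcal C\subset\mathcal A$ is a commutative subalgebra containing $I$ such that each $a\in\mathcal C$ satisfies $-tI\le a\le tI$ for some $t>0$. If $\mathcal A_+$ is closed, there is a Hausdorff compact set $X$, unique up to homeomorphism (the phase space), such that $\mathcal C$ is isomorphic, including the order, to a dense subalgebra of $C(X)$ (real continuous functions, supremum norm); $\mathcal C$ is identified with this subalgebra. When $\mathcal A$ is moreover complete, the inclusion $\mathcal C\to\mathcal A$ extends uniquely to a continuous, injective, positive homomorphism $C(X)\to\mathcal A$, by which $C(X)$ is regarded as a subalgebra of $\mathcal A$. A covariant positive flow $(\mathcal A,\mathcal C,E,\alpha^* )$ consists of a positive algebra $\mathcal A$, complete in norm, with closed cone $\mathcal A_+$; a phase subalgebra $\mathcal C$ with phase space $X$; an element $E\in\mathcal A_+$; and a positive unital homomorphism $\alpha^*:\mathcal C\to\mathcal C$ with $Ef=\alpha^*(f)E$ for all $f\in\mathcal C$. There is a unique continuous $\alpha:X\to X$ with $\alpha^*(f)=f\circ\alpha$. For $\varphi\in C(X)$ put $E_\varphi=e^\varphi E$. The spectral potential is $\lambda(\varphi)=\lim_{n\to\infty}\frac1n\ln\|E_\varphi^n\|$;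 standing assumption: $\lambda$ is finite on $C(X)$ (otherwise $\lambda\equiv-\infty$). A state is a positive continuous linear functional $\nu$ on $\mathcal A$; its restriction to $C(X)$ is identified with a (regular) Borel measure on $X$ via the Riesz theorem, also denoted $\nu$. A state $\nu$ is $\varphi$-sensitive if $\lim_{n\to\infty}\frac1n\ln\nu(E_\varphi^n)=\lambda(\varphi)$. It is a right eigen-state for $E_\varphi$ (corresponding to $\varphi$) if $\nu(AE_\varphi)=e^{\lambda(\varphi)}\nu(A)$ for all $A\in\mathcal A$. $P_n$ is the Borel probability measure on $X$ given by $P_n(g)=\nu(gE_\varphi^n)/\nu(E_\varphi^n)$, $g\in C(X)$ (defined for all sufficiently large $n$). Empirical measures: $\delta_{x,n}(f)=\frac1n\sum_{i=0}^{n-1}f(\alpha^i(x))$. *)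

theory Defs
  imports "HOL-Analysis.Analysis"
begin

section \<open>Positive algebras and phase subalgebras\<close>

text \<open>The sort \<open>real_normed_algebra_1\<close> is exactly that of real associative normed algebras with
  \<open>norm (a * b) \<le> norm a * norm b\<close>, a unit \<open>1\<close> and \<open>norm 1 = 1\<close>. The cone is a set parameter, and
  the order it induces is kept as a relation rather than a type class.\<close>

definition cone_le :: "'a::real_vector set \<Rightarrow> 'a \<Rightarrow> 'a \<Rightarrow> bool" where
  "cone_le K u v \<longleftrightarrow> v - u \<in> K"

locale positive_algebra =
  fixes Pos :: "'a::real_normed_algebra_1 set"
  assumes convex_Pos: "convex Pos"
    and cone_Pos: "cone Pos"
    and pointed_Pos: "\<And>v. v \<in> Pos \<Longrightarrow> - v \<in> Pos \<Longrightarrow> v = 0"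
    and mult_Pos: "\<And>u v. u \<in> Pos \<Longrightarrow> v \<in> Pos \<Longrightarrow> u * v \<in> Pos"
    and one_Pos: "1 \<in> Pos"
    and norm_mono: "\<And>u v. u \<in> Pos \<Longrightarrow> v \<in> Pos \<Longrightarrow> norm u \<le> norm (u + v)"

locale phase_subalgebra = positive_algebra Pos
  for Pos :: "'a::real_normed_algebra_1 set" +
  fixes C :: "'a set"
  assumes subspace_C: "subspace C"
    and mult_C: "\<And>a b. a \<in> C \<Longrightarrow> b \<in> C \<Longrightarrow> a * b \<in> C"
    and commute_C: "\<And>a b. a \<in> C \<Longrightarrow> b \<in> C \<Longrightarrow> a * b = b * a"
    and one_C: "1 \<in> C"
    and order_bounded_C:
      "\<And>a. a \<in> C \<Longrightarrow> \<exists>t>0. cone_le Pos (- (t *\<^sub>R 1)) a \<and> cone_le Pos a (t *\<^sub>R 1)"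

section \<open>The phase space\<close>

text \<open>The phase space is the type \<open>'x\<close>, and \<open>C(X)\<close> with the supremum norm is the type
  \<open>'x \<Rightarrow>\<^sub>C real\<close> of bounded continuous functions (boundedness is automatic, \<open>'x\<close> being compact).
  The map \<open>\<Phi>\<close>, relevant only on \<open>C\<close>, is the order isomorphism of \<open>C\<close> onto a dense subalgebra of
  \<open>C(X)\<close>. As \<open>'x \<Rightarrow>\<^sub>C real\<close> carries no multiplication in the library, multiplicativity
  is stated pointwise.\<close>

locale phase_space = phase_subalgebra Pos C
  for Pos :: "'a::real_normed_algebra_1 set" and C +
  fixes \<Phi> :: "'a \<Rightarrow> ('x::t2_space \<Rightarrow>\<^sub>C real)"
  assumes compact_X: "compact (UNIV :: 'x set)"
    and \<Phi>_add: "\<And>a b. a \<in> C \<Longrightarrow> b \<in> C \<Longrightarrow> \<Phi> (a + b) = \<Phi> a + \<Phi> b"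
    and \<Phi>_scaleR: "\<And>t a. a \<in> C \<Longrightarrow> \<Phi> (t *\<^sub>R a) = t *\<^sub>R \<Phi> a"
    and \<Phi>_mult: "\<And>a b x. a \<in> C \<Longrightarrow> b \<in> C \<Longrightarrow> \<Phi> (a * b) x = \<Phi> a x * \<Phi> b x"
    and \<Phi>_one: "\<And>x. \<Phi> 1 x = 1"
    and \<Phi>_inj: "inj_on \<Phi> C"
    and \<Phi>_order: "\<And>a b. a \<in> C \<Longrightarrow> b \<in> C \<Longrightarrow> cone_le Pos a b \<longleftrightarrow> (\<forall>x. \<Phi> a x \<le> \<Phi> b x)"
    and \<Phi>_dense: "closure (\<Phi> ` C) = UNIV"

text \<open>The embedding of \<open>C(X)\<close> into the algebra: the unique continuous extension of the
  inclusion \<open>C \<rightarrow> \<A>\<close>, where \<open>C\<close> is identified with \<open>\<Phi> ` C\<close>. Density of \<open>\<Phi> ` C\<close> makes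
  continuity alone determine it; being an injective positive homomorphism is a consequence.\<close>

definition embed_CX :: "'a::banach set \<Rightarrow> ('a \<Rightarrow> ('x::topological_space \<Rightarrow>\<^sub>C real)) \<Rightarrow>
    ('x \<Rightarrow>\<^sub>C real) \<Rightarrow> 'a" where
  "embed_CX C \<Phi> = (THE j. continuous_on UNIV j \<and> (\<forall>c\<in>C. j (\<Phi> c) = c))"

section \<open>Covariant positive flows\<close>

text \<open>The homomorphism \<open>\<alpha>\<^sup>*\<close> is the parameter \<open>A\<close>, relevant only on \<open>C\<close>.\<close>

locale covariant_positive_flow = phase_subalgebra Pos C
  for Pos :: "'a::{real_normed_algebra_1,banach} set" and C +
  fixes E :: 'a and A :: "'a \<Rightarrow> 'a"
  assumes closed_Pos: "closed Pos"
    and E_Pos: "E \<in> Pos"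
    and A_in_C: "\<And>a. a \<in> C \<Longrightarrow> A a \<in> C"
    and A_add: "\<And>a b. a \<in> C \<Longrightarrow> b \<in> C \<Longrightarrow> A (a + b) = A a + A b"
    and A_scaleR: "\<And>t a. a \<in> C \<Longrightarrow> A (t *\<^sub>R a) = t *\<^sub>R A a"
    and A_mult: "\<And>a b. a \<in> C \<Longrightarrow> b \<in> C \<Longrightarrow> A (a * b) = A a * A b"
    and A_one: "A 1 = 1"
    and A_positive: "\<And>a. a \<in> C \<Longrightarrow> a \<in> Pos \<Longrightarrow> A a \<in> Pos"
    and covariance: "\<And>a. a \<in> C \<Longrightarrow> E * a = A a * E"

text \<open>The unique continuous self-map of the phase space inducing \<open>\<alpha>\<^sup>*\<close>. Requiring
  \<open>\<alpha>\<^sup>*(f) = f \<circ> \<alpha>\<close> on the dense subalgebra \<open>C\<close> suffices, because \<open>C\<close> separates points.\<close>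

definition phase_map :: "'a set \<Rightarrow> ('a \<Rightarrow> ('x::topological_space \<Rightarrow>\<^sub>C real)) \<Rightarrow> ('a \<Rightarrow> 'a) \<Rightarrow>
    'x \<Rightarrow> 'x" where
  "phase_map C \<Phi> A =
    (THE \<alpha>. continuous_on UNIV \<alpha> \<and> (\<forall>c\<in>C. \<forall>x. \<Phi> (A c) x = \<Phi> c (\<alpha> x)))"

section \<open>Spectral potential\<close>

definition exp_C :: "('x::topological_space \<Rightarrow>\<^sub>C real) \<Rightarrow> ('x \<Rightarrow>\<^sub>C real)" where
  "exp_C \<phi> = Bcontfun (\<lambda>x. exp (\<phi> x))"

definition E_phi :: "'a::{real_normed_algebra_1,banach} set \<Rightarrow>
    ('a \<Rightarrow> ('x::topological_space \<Rightarrow>\<^sub>C real)) \<Rightarrow> 'a \<Rightarrow> ('x \<Rightarrow>\<^sub>C real) \<Rightarrow> 'a" where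
  "E_phi C \<Phi> E \<phi> = embed_CX C \<Phi> (exp_C \<phi>) * E"

text \<open>Logarithm of a nonnegative real with \<open>ln 0 = - \<infinity>\<close>; the library has \<open>ln 0 = 0\<close>.\<close>

definition ln_ext :: "real \<Rightarrow> ereal" where
  "ln_ext r = (if r > 0 then ereal (ln r) else - \<infinity>)"

definition spectral_potential :: "'a::{real_normed_algebra_1,banach} set \<Rightarrow>
    ('a \<Rightarrow> ('x::topological_space \<Rightarrow>\<^sub>C real)) \<Rightarrow> 'a \<Rightarrow> ('x \<Rightarrow>\<^sub>C real) \<Rightarrow> ereal" where
  "spectral_potential C \<Phi> E \<phi> =
    lim (\<lambda>n. ln_ext (norm (E_phi C \<Phi> E \<phi> ^ n)) / ereal (real n))"

section \<open>States and their measures\<close>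

definition state :: "'a::real_normed_algebra_1 set \<Rightarrow> ('a \<Rightarrow> real) \<Rightarrow> bool" where
  "state Pos \<nu> \<longleftrightarrow> bounded_linear \<nu> \<and> (\<forall>a\<in>Pos. 0 \<le> \<nu> a)"

definition sensitive :: "'a::{real_normed_algebra_1,banach} set \<Rightarrow>
    ('a \<Rightarrow> ('x::topological_space \<Rightarrow>\<^sub>C real)) \<Rightarrow> 'a \<Rightarrow> ('x \<Rightarrow>\<^sub>C real) \<Rightarrow> ('a \<Rightarrow> real) \<Rightarrow> bool" where
  "sensitive C \<Phi> E \<phi> \<nu> \<longleftrightarrow>
    (\<lambda>n. ln_ext (\<nu> (E_phi C \<Phi> E \<phi> ^ n)) / ereal (real n))
      \<longlonglongrightarrow> spectral_potential C \<Phi> E \<phi>"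

text \<open>To be used when the spectral potential is finite, so that \<open>real_of_ereal\<close> is faithful.\<close>

definition right_eigen_state :: "'a::{real_normed_algebra_1,banach} set \<Rightarrow>
    ('a \<Rightarrow> ('x::topological_space \<Rightarrow>\<^sub>C real)) \<Rightarrow> 'a \<Rightarrow> ('x \<Rightarrow>\<^sub>C real) \<Rightarrow> ('a \<Rightarrow> real) \<Rightarrow> bool" where
  "right_eigen_state C \<Phi> E \<phi> \<nu> \<longleftrightarrow>
    (\<forall>a. \<nu> (a * E_phi C \<Phi> E \<phi>) = exp (real_of_ereal (spectral_potential C \<Phi> E \<phi>)) * \<nu> a)"

definition regular_borel :: "'x::topological_space measure \<Rightarrow> bool" where
  "regular_borel M \<longleftrightarrow> sets M = sets borel \<and> finite_measure M \<and>
    (\<forall>B\<in>sets borel.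
      emeasure M B = (INF U\<in>{U. open U \<and> B \<subseteq> U}. emeasure M U) \<and>
      emeasure M B = (SUP K\<in>{K. compact K \<and> K \<subseteq> B}. emeasure M K))"

text \<open>\<open>M\<close> is the measure that the Riesz theorem associates with the functional \<open>L\<close> on \<open>C(X)\<close>;
  regularity makes it unique on an arbitrary compact Hausdorff space.\<close>

definition riesz_measure :: "'x::topological_space measure \<Rightarrow> (('x \<Rightarrow>\<^sub>C real) \<Rightarrow> real) \<Rightarrow> bool" where
  "riesz_measure M L \<longleftrightarrow> regular_borel M \<and> (\<forall>g. integral\<^sup>L M (apply_bcontfun g) = L g)"

definition empirical :: "('x \<Rightarrow> 'x) \<Rightarrow> 'x \<Rightarrow> nat \<Rightarrow> ('x::topological_space \<Rightarrow>\<^sub>C real) \<Rightarrow> real" where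
  "empirical \<alpha> x n f = (\<Sum>i<n. f ((\<alpha> ^^ i) x)) / real n"

end

theory Submission
  imports Defs
begin

text \<open>Covariance gives \<open>E\<^bsub>\<phi>+tf\<^esub>\<^sup>n = e\<^bsup>t S\<^esup> E\<^sub>\<phi>\<^sup>n\<close>, where \<open>S\<close> is the \<open>n\<close>-th Birkhoff sum of \<open>f\<close>.
  Hence the exponential moment \<open>P\<^sub>n(e\<^bsup>t S\<^esup>)\<close> equals \<open>\<nu>(E\<^bsub>\<phi>+tf\<^esub>\<^sup>n) / \<nu>(E\<^sub>\<phi>\<^sup>n)\<close>, which grows at
  most like \<open>exp (n (\<lambda>(\<phi> + tf) - \<lambda>(\<phi>)))\<close>. As the exponent is \<open>n (t a + o(t))\<close>, Markov's inequality
  with a small \<open>t > 0\<close> shows that deviations of the empirical means above \<open>a\<close> are exponentially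
  unlikely; replacing \<open>f\<close> by \<open>-f\<close> handles deviations below. For an eigen-state the measures \<open>P\<^sub>n\<close>
  all agree with the normalised \<open>\<nu>\<close>, and the strong law follows from the Borel--Cantelli lemma.\<close>

section \<open>Exponential growth rates\<close>

text \<open>Fekete's argument: writing n = q * m + r with r < m, subadditivity gives v n \<le> q * v
  m + v r, and the remainder disappears after division by n.\<close>

lemma subadditive_limsup_le:
  fixes v :: "nat \<Rightarrow> real"
  assumes sub: "\<And>m n. v (m + n) \<le> v m + v n" and m: "m > 0"
  shows "limsup (\<lambda>n. ereal (v n / real n)) \<le> ereal (v m / real m)"
proof -
  \<comment> \<open>The term \<open>\<bar>v m\<bar>\<close> pays for replacing
    \<open>n div m\<close> by n / m, which matters when \<open>v m\<close> is negative; the sum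
    dominates \<open>v r\<close> for every possible remainder.\<close>
  define D where "D = \<bar>v m\<bar> + (\<Sum>r<m. \<bar>v r\<bar>)"
  have mult: "v (q * m + r) \<le> real q * v m + v r" for q r
  proof (induction q)
    case (Suc q)
    have "v (Suc q * m + r) \<le> v m + v (q * m + r)"
      using sub[of m "q * m + r"] by (simp add: add.assoc)
    with Suc show ?case by (simp add: algebra_simps)
  qed simp
  have bound: "v n / real n \<le> v m / real m + D / real n" if "n > 0" for n
  proof -
    have "v n \<le> real (n div m) * v m + v (n mod m)"
      using mult[of "n div m" "n mod m"] by simp
    moreover have "v (n mod m) \<le> (\<Sum>r<m. \<bar>v r\<bar>)"
      using member_le_sum[of "n mod m" "{..<m}" "\<lambda>r. \<bar>v r\<bar>"] m by simp
    moreover have "real (n div m) * v m \<le> real n * (v m / real m) + \<bar>v m\<bar>"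
    proof -
      have "real (n div m) * real m + real (n mod m) = real n"
        by (metis div_mult_mod_eq of_nat_add of_nat_mult)
      then have eq: "real (n div m) = real n / real m - real (n mod m) / real m"
        using m by (simp add: field_simps)
      have "real (n mod m) / real m * \<bar>v m\<bar> \<le> 1 * \<bar>v m\<bar>"
        using m by (intro mult_right_mono) auto
      moreover have "- (real (n mod m) / real m * v m) \<le> real (n mod m) / real m * \<bar>v m\<bar>"
        by (metis abs_ge_minus_self abs_mult abs_of_nonneg divide_nonneg_nonneg of_nat_0_le_iff)
      ultimately show ?thesis unfolding eq by (simp add: algebra_simps)
    qed
    ultimately have "v n \<le> real n * (v m / real m) + D" unfolding D_def by linarith
    then show ?thesis using that by (simp add: field_simps)
  qed
  have "(\<lambda>n. v m / real m + D / real n) \<longlonglongrightarrow> v m / real m"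
    using tendsto_add[OF tendsto_const[of "v m / real m"] lim_const_over_n[of D]] by simp
  then have "limsup (\<lambda>n. ereal (v m / real m + D / real n)) = ereal (v m / real m)"
    by (intro lim_imp_Limsup) (auto intro: tendsto_ereal)
  moreover have "limsup (\<lambda>n. ereal (v n / real n)) \<le> limsup (\<lambda>n. ereal (v m / real m + D / real n))"
    by (intro Limsup_mono eventually_sequentiallyI[of 1]) (use bound in auto)
  ultimately show ?thesis by simp
qed

text \<open>Fekete's lemma applied to ln u. A single zero of u forces all later values to be zero,
  and the limit is then -\<infinity>; this is why convergence is taken in the extended
  reals.\<close>

lemma convergent_ln_ext_submultiplicative:
  fixes u :: "nat \<Rightarrow> real"
  assumes nonneg: "\<And>n. u n \<ge> 0" and sub: "\<And>m n. u (m + n) \<le> u m * u n"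
  shows "convergent (\<lambda>n. ln_ext (u n) / ereal (real n))"
proof (cases "\<exists>k. u k = 0")
  case True
  then obtain k where k: "u k = 0" by blast
  have "ln_ext (u n) / ereal (real n) = - \<infinity>" if "n \<ge> Suc k" for n
    using sub[of k "n - k"] nonneg[of n] k that by (simp add: ln_ext_def)
  then have "(\<lambda>n. ln_ext (u n) / ereal (real n)) \<longlonglongrightarrow> - \<infinity>"
    by (intro tendsto_eventually eventually_sequentiallyI)
  then show ?thesis by (auto simp: convergent_def)
next
  case False
  then have pos: "u n > 0" for n using nonneg[of n] by (simp add: order_less_le)
  define s where "s n = ereal (ln (u n) / real n)" for n
  have "ln (u (m + n)) \<le> ln (u m) + ln (u n)" for m n
    using sub[of m n] pos by (simp add: ln_mult_pos[symmetric])
  then have le: "limsup s \<le> s m" if "m > 0" for m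
    unfolding s_def using subadditive_limsup_le[of "\<lambda>n. ln (u n)"] that by blast
  \<comment> \<open>The limsup is a lower bound of all terms with positive index, hence also of
    their liminf.\<close>
  have "limsup s \<le> liminf s"
    by (intro Liminf_bounded eventually_sequentiallyI[of 1]) (use le in auto)
  then have "limsup s = liminf s"
    by (intro antisym Liminf_le_Limsup) auto
  then have "s \<longlonglongrightarrow> limsup s"
    by (simp add: tendsto_iff_Liminf_eq_Limsup)
  moreover have "\<forall>\<^sub>F n in sequentially. s n = ln_ext (u n) / ereal (real n)"
    by (intro eventually_sequentiallyI[of 1]) (use pos in \<open>auto simp: s_def ln_ext_def\<close>)
  ultimately have "(\<lambda>n. ln_ext (u n) / ereal (real n)) \<longlonglongrightarrow> limsup s"
    by (rule Lim_transform_eventually)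
  then show ?thesis by (auto simp: convergent_def)
qed

text \<open>The two sides of the limit, exponentiated. No sign is assumed for \<open>u n\<close>:
  the upper bound is trivial when \<open>u n \<le> 0\<close>, and the lower one excludes that case
  eventually, since \<open>ln_ext\<close> would be -\<infinity> there.\<close>

lemma eventually_growth_bounds:
  assumes lim: "(\<lambda>n. ln_ext (u n) / ereal (real n)) \<longlonglongrightarrow> ereal l" and "\<delta> > 0"
  shows "\<forall>\<^sub>F n in sequentially. u n \<le> exp (real n * (l + \<delta>))"
    and "\<forall>\<^sub>F n in sequentially. exp (real n * (l - \<delta>)) \<le> u n"
proof -
  have "\<forall>\<^sub>F n in sequentially. ln_ext (u n) / ereal (real n) < ereal (l + \<delta>)"
    using order_tendstoD(2)[OF lim] \<open>\<delta> > 0\<close> by simp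
  then show "\<forall>\<^sub>F n in sequentially. u n \<le> exp (real n * (l + \<delta>))"
    using eventually_gt_at_top[of 0]
  proof eventually_elim
    case (elim n)
    show ?case
    proof (cases "u n > 0")
      case True
      then have "ln (u n) < real n * (l + \<delta>)"
        using elim by (simp add: ln_ext_def field_simps)
      then show ?thesis using True by (metis exp_less_mono exp_ln less_imp_le)
    next
      case False
      then show ?thesis using exp_gt_zero[of "real n * (l + \<delta>)"] by linarith
    qed
  qed
  have "\<forall>\<^sub>F n in sequentially. ereal (l - \<delta>) < ln_ext (u n) / ereal (real n)"
    using order_tendstoD(1)[OF lim] \<open>\<delta> > 0\<close> by simp
  then show "\<forall>\<^sub>F n in sequentially. exp (real n * (l - \<delta>)) \<le> u n"
    using eventually_gt_at_top[of 0]
  proof eventually_elim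
    case (elim n)
    have pos: "u n > 0"
    proof (rule ccontr)
      assume "\<not> u n > 0"
      then have "ln_ext (u n) / ereal (real n) = - \<infinity>" using elim by (simp add: ln_ext_def)
      with elim show False by simp
    qed
    then have "real n * (l - \<delta>) < ln (u n)"
      using elim by (simp add: ln_ext_def field_simps)
    then show ?case using pos by (metis exp_less_mono exp_ln less_imp_le)
  qed
qed

section \<open>The phase space inside the algebra\<close>

locale phased_flow = covariant_positive_flow Pos C E A + phase_space Pos C \<Phi>
  for Pos C :: "'a::{real_normed_algebra_1,banach} set" and E A
    and \<Phi> :: "'a \<Rightarrow> ('x::t2_space \<Rightarrow>\<^sub>C real)"
begin

abbreviation J :: "('x \<Rightarrow>\<^sub>C real) \<Rightarrow> 'a" where "J \<equiv> embed_CX C \<Phi>"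

abbreviation \<alpha> :: "'x \<Rightarrow> 'x" where "\<alpha> \<equiv> phase_map C \<Phi> A"

lemma apply_Bcontfun:
  fixes h :: "'x \<Rightarrow> real"
  assumes "continuous_on UNIV h"
  shows "apply_bcontfun (Bcontfun h) = h"
proof (rule Bcontfun_inverse)
  show "h \<in> bcontfun"
    using assms compact_imp_bounded[OF compact_continuous_image[OF assms compact_X]]
    by (simp add: bcontfun_def)
qed

lemma scaleR_one_C: "t *\<^sub>R 1 \<in> C"
  using one_C subspace_C by (simp add: subspace_scale)

lemma \<Phi>_scaleR_one [simp]: "\<Phi> (t *\<^sub>R 1) x = t"
  using \<Phi>_scaleR[OF one_C] \<Phi>_one by simp

lemma \<Phi>_diff:
  assumes "a \<in> C" "b \<in> C"
  shows "\<Phi> (a - b) = \<Phi> a - \<Phi> b"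
proof -
  have "- 1 *\<^sub>R b \<in> C" using assms subspace_C by (metis subspace_scale)
  then show ?thesis
    using \<Phi>_add[OF assms(1), of "- 1 *\<^sub>R b"] \<Phi>_scaleR[OF assms(2), of "- 1"] by simp
qed

text \<open>With s the supremum norm, the order isomorphism gives -s \<le> c \<le> s in the algebra.
  Monotonicity of the norm for 0 \<le> c + s \<le> 2s yields norm at most 2s, and removing the shift
  costs another s.\<close>

lemma norm_le_norm_\<Phi>:
  assumes "c \<in> C"
  shows "norm c \<le> 3 * norm (\<Phi> c)"
proof -
  define s where "s = norm (\<Phi> c)"
  have bd: "\<bar>\<Phi> c x\<bar> \<le> s" for x
    using norm_bounded[of "\<Phi> c" x] by (simp add: s_def)
  have "cone_le Pos c (s *\<^sub>R 1)" "cone_le Pos ((- s) *\<^sub>R 1) c"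
    using bd by (auto simp: \<Phi>_order[OF assms scaleR_one_C] \<Phi>_order[OF scaleR_one_C assms] abs_le_iff
        simp del: scaleR_minus_left) (metis minus_le_iff)
  then have "norm (c + s *\<^sub>R 1) \<le> norm ((c + s *\<^sub>R 1) + (s *\<^sub>R 1 - c))"
    by (intro norm_mono) (simp_all add: cone_le_def)
  also have "(c + s *\<^sub>R 1) + (s *\<^sub>R 1 - c) = (2 * s) *\<^sub>R 1"
    by (simp add: scaleR_2[symmetric])
  finally have "norm (c + s *\<^sub>R 1) \<le> 2 * s" by (simp add: s_def)
  moreover have "norm c \<le> norm (c + s *\<^sub>R 1) + norm (s *\<^sub>R (1::'a))"
    using norm_triangle_ineq4[of "c + s *\<^sub>R 1" "s *\<^sub>R 1"] by simp
  ultimately show ?thesis by (simp add: s_def)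
qed

lemma embed_CX_ex1: "\<exists>!j. continuous_on UNIV j \<and> (\<forall>c\<in>C. j (\<Phi> c) = c)"
proof -
  define h where "h = inv_into C \<Phi>"
  have h: "h (\<Phi> c) = c" if "c \<in> C" for c
    using that \<Phi>_inj by (simp add: h_def)
  have "3-lipschitz_on (\<Phi> ` C) h"
  proof (rule lipschitz_onI)
    fix x y assume "x \<in> \<Phi> ` C" "y \<in> \<Phi> ` C"
    then obtain c d where "c \<in> C" "d \<in> C" and [simp]: "x = \<Phi> c" "y = \<Phi> d" by blast
    then show "dist (h x) (h y) \<le> 3 * dist x y"
      using norm_le_norm_\<Phi>[of "c - d"] subspace_diff[OF subspace_C]
      by (simp add: h dist_norm \<Phi>_diff)
  qed simp
  then have "uniformly_continuous_on (\<Phi> ` C) h"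
    by (rule lipschitz_on_uniformly_continuous)
  then obtain g where g: "uniformly_continuous_on (closure (\<Phi> ` C)) g"
      "\<And>x. x \<in> \<Phi> ` C \<Longrightarrow> h x = g x"
    and uniq: "\<And>Y k x. \<Phi> ` C \<subseteq> Y \<Longrightarrow> Y \<subseteq> closure (\<Phi> ` C) \<Longrightarrow> continuous_on Y k \<Longrightarrow>
        (\<And>x. x \<in> \<Phi> ` C \<Longrightarrow> h x = k x) \<Longrightarrow> x \<in> Y \<Longrightarrow> k x = g x"
    using uniformly_continuous_on_extension_on_closure by blast
  show ?thesis
  proof (rule ex1I[of _ g])
    show "continuous_on UNIV g \<and> (\<forall>c\<in>C. g (\<Phi> c) = c)"
      using g h \<Phi>_dense uniformly_continuous_imp_continuous by (metis imageI)
    show "k = g" if "continuous_on UNIV k \<and> (\<forall>c\<in>C. k (\<Phi> c) = c)" for k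
    proof
      fix x show "k x = g x"
        using uniq[of UNIV k x] that h \<Phi>_dense by fastforce
    qed
  qed
qed

lemma continuous_on_J: "continuous_on UNIV J" and J_\<Phi>: "c \<in> C \<Longrightarrow> J (\<Phi> c) = c"
  using theI'[OF embed_CX_ex1] unfolding embed_CX_def by blast+

lemma tendsto_J:
  assumes "(X \<longlongrightarrow> g) F"
  shows "((\<lambda>n. J (X n)) \<longlongrightarrow> J g) F"
  using continuous_on_tendsto_compose[OF continuous_on_J assms] by simp

lemma dense_sequence:
  obtains c where "\<And>n. c n \<in> C" "(\<lambda>n. \<Phi> (c n)) \<longlonglongrightarrow> g"
proof -
  have "g \<in> closure (\<Phi> ` C)" using \<Phi>_dense by simp
  then obtain X where X: "\<And>n. X n \<in> \<Phi> ` C" "X \<longlonglongrightarrow> g"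
    unfolding closure_sequential by blast
  then have "\<forall>n. \<exists>c. c \<in> C \<and> X n = \<Phi> c" by blast
  then obtain c where "\<And>n. c n \<in> C \<and> X n = \<Phi> (c n)" by metis
  then show thesis using X(2) that[of c] by presburger
qed

text \<open>Both sides are limits of \<open>c n * d n\<close> for approximating sequences from
  \<open>C\<close>: products of uniformly convergent bounded functions converge uniformly, and
  \<open>J\<close> is continuous.\<close>

lemma J_mult:
  assumes cont: "continuous_on UNIV g" "continuous_on UNIV h"
  shows "J (Bcontfun (\<lambda>x. g x * h x)) = J (Bcontfun g) * J (Bcontfun h)"
proof -
  obtain c where c: "\<And>n. c n \<in> C" "(\<lambda>n. \<Phi> (c n)) \<longlonglongrightarrow> Bcontfun g" using dense_sequence by blast
  obtain d where d: "\<And>n. d n \<in> C" "(\<lambda>n. \<Phi> (d n)) \<longlonglongrightarrow> Bcontfun h" using dense_sequence by blast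
  have "uniform_limit UNIV (\<lambda>n x. \<Phi> (c n) x * \<Phi> (d n) x)
      (\<lambda>x. Bcontfun g x * Bcontfun h x) sequentially"
    by (intro uniform_lim_mult tendsto_bcontfun_uniform_limit c d bounded_apply_bcontfun)
  then have "uniform_limit UNIV (\<lambda>n. apply_bcontfun (\<Phi> (c n * d n)))
      (apply_bcontfun (Bcontfun (\<lambda>x. g x * h x))) sequentially"
    using \<Phi>_mult[OF c(1) d(1)] cont by (simp add: apply_Bcontfun continuous_on_mult cong: uniform_limit_cong')
  then have "(\<lambda>n. \<Phi> (c n * d n)) \<longlonglongrightarrow> Bcontfun (\<lambda>x. g x * h x)"
    by (rule uniform_limit_tendsto_bcontfun)
  from tendsto_J[OF this] have "(\<lambda>n. c n * d n) \<longlonglongrightarrow> J (Bcontfun (\<lambda>x. g x * h x))"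
    using c(1) d(1) by (simp add: J_\<Phi> mult_C)
  moreover have "(\<lambda>n. c n * d n) \<longlonglongrightarrow> J (Bcontfun g) * J (Bcontfun h)"
    using tendsto_mult[OF tendsto_J[OF c(2)] tendsto_J[OF d(2)]] c(1) d(1) by (simp add: J_\<Phi>)
  ultimately show ?thesis by (rule LIMSEQ_unique)
qed

lemma J_one: "J (Bcontfun (\<lambda>x. 1)) = 1"
proof -
  have "Bcontfun (\<lambda>x. 1) = \<Phi> 1"
    by (rule bcontfun_eqI) (simp add: apply_Bcontfun \<Phi>_one)
  then show ?thesis using J_\<Phi>[OF one_C] by simp
qed

section \<open>The phase map\<close>

text \<open>Urysohn's lemma gives a continuous function equal to 0 at y and 1 at z. An element of
  the dense subalgebra within less than 1/2 of it stays below 1/2 at y and above 1/2 at z.\<close>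

lemma \<Phi>_separates:
  assumes "y \<noteq> z"
  obtains c where "c \<in> C" "\<Phi> c y \<noteq> \<Phi> c z"
proof -
  have "Hausdorff_space (euclidean :: 'x topology)"
    unfolding Hausdorff_space_def disjnt_def using hausdorff by (auto; blast)
  then have "normal_space (euclidean :: 'x topology)"
    using compact_X compact_Hausdorff_or_regular_imp_normal_space compact_space_def by force
  then obtain g where g: "continuous_map euclidean (top_of_set {0..1}) g" "g ` {y} \<subseteq> {0::real}" "g ` {z} \<subseteq> {1}"
    using Urysohn_lemma[of "euclidean :: 'x topology" "{y}" "{z}" 0 1] assms by auto
  then have cont: "continuous_on UNIV g"
    by (simp add: continuous_map_in_subtopology)
  have "Bcontfun g \<in> closure (\<Phi> ` C)" using \<Phi>_dense by simp
  then obtain c where c: "c \<in> C" "dist (\<Phi> c) (Bcontfun g) < 1/2"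
    unfolding closure_approachable by (metis half_gt_zero imageE zero_less_one)
  have "dist (\<Phi> c x) (g x) < 1/2" for x
    using dist_fun_lt_imp_dist_val_lt[OF c(2), of x] cont by (simp add: apply_Bcontfun)
  from this[of y] this[of z] have "\<Phi> c y \<noteq> \<Phi> c z"
    using g by (auto simp: dist_real_def)
  with c(1) show thesis by (rule that)
qed

text \<open>Otherwise each point \<open>y\<close> has a witness in \<open>C\<close>, and a finite sum of squares of such witnesses
  would be bounded below by a positive constant although its image under \<open>A\<close> vanishes at \<open>x\<close>.\<close>

lemma phase_point_exists: "\<exists>y. \<forall>c\<in>C. \<Phi> (A c) x = \<Phi> c y"
proof (rule ccontr)
  assume "\<not> ?thesis"
  then have "\<forall>y. \<exists>c. c \<in> C \<and> \<Phi> (A c) x \<noteq> \<Phi> c y" by metis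
  then obtain w where w: "\<And>y. w y \<in> C" "\<And>y. \<Phi> (A (w y)) x \<noteq> \<Phi> (w y) y" by metis
  \<comment> \<open>Subtracting the constant makes the image of \<open>e y\<close> under
    \<open>A\<close> vanish at x, while \<open>e y\<close> itself is nonzero at y. The square
    \<open>d y\<close> is in addition nonnegative everywhere.\<close>
  define e where "e y = w y - \<Phi> (A (w y)) x *\<^sub>R 1" for y
  define d where "d y = e y * e y" for y
  have eC: "e y \<in> C" for y
    unfolding e_def by (intro subspace_diff subspace_C w scaleR_one_C)
  then have dC: "d y \<in> C" for y by (simp add: d_def mult_C)
  have A_diff: "A (a - b) = A a - A b" if "a \<in> C" "b \<in> C" for a b
  proof -
    have "- 1 *\<^sub>R b \<in> C" using that subspace_C by (metis subspace_scale)
    then show ?thesis using A_add[OF that(1), of "- 1 *\<^sub>R b"] A_scaleR[OF that(2), of "- 1"] by simp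
  qed
  have A_scaleR_one: "A (t *\<^sub>R 1) = t *\<^sub>R 1" for t
    by (simp add: A_scaleR[OF one_C] A_one)
  have "\<Phi> (A (e y)) x = 0" for y
    using w scaleR_one_C by (simp add: e_def A_diff A_scaleR_one \<Phi>_diff A_in_C)
  then have Ad: "\<Phi> (A (d y)) x = 0" for y
    using eC by (simp add: d_def A_mult A_in_C \<Phi>_mult)
  have dval: "\<Phi> (d y) z = (\<Phi> (e y) z)\<^sup>2" for y z
    using eC by (simp add: d_def \<Phi>_mult power2_eq_square)
  have dpos: "\<Phi> (d y) y > 0" for y
  proof -
    have "\<Phi> (e y) y = \<Phi> (w y) y - \<Phi> (A (w y)) x"
      using w(1) scaleR_one_C by (simp add: e_def \<Phi>_diff)
    then have "\<Phi> (e y) y \<noteq> 0" using w(2)[of y] by simp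
    then show ?thesis by (simp add: dval)
  qed
  define U where "U y = {z. \<Phi> (d y) z > 0}" for y
  have "open (U y)" for y
    unfolding U_def by (intro open_Collect_less continuous_intros continuous_on_apply_bcontfun)
  moreover have "UNIV \<subseteq> (\<Union>y\<in>UNIV. U y)" using dpos by (auto simp: U_def)
  ultimately obtain F where F: "finite F" "UNIV \<subseteq> (\<Union>y\<in>F. U y)"
    using compactE_image[OF compact_X, of UNIV U] by (metis subset_UNIV)
  define s where "s = (\<Sum>y\<in>F. d y)"
  have sum_facts: "sum d G \<in> C \<and> (\<forall>z. \<Phi> (sum d G) z = (\<Sum>y\<in>G. \<Phi> (d y) z)) \<and> \<Phi> (A (sum d G)) x = 0"
    if "finite G" for G
    using that
  proof (induction G rule: finite_induct)
    case empty
    have "0 \<in> C" using subspace_C by (simp add: subspace_0)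
    then show ?case using \<Phi>_scaleR[of 0 0] A_scaleR[of 0 0] by simp
  next
    case (insert y G)
    then show ?case
      using dC[of y] Ad[of y] subspace_add[OF subspace_C]
      by (simp add: \<Phi>_add A_add A_in_C)
  qed
  have s: "s \<in> C" "\<And>z. \<Phi> s z = (\<Sum>y\<in>F. \<Phi> (d y) z)" "\<Phi> (A s) x = 0"
    using sum_facts[OF F(1)] by (auto simp: s_def)
  have s_pos: "\<Phi> s z > 0" for z
  proof -
    obtain y where y: "y \<in> F" "z \<in> U y" using F(2) by blast
    then show ?thesis
      unfolding s(2) using F(1) by (intro sum_pos2[of F y]) (auto simp: U_def dval)
  qed
  obtain z where z: "\<And>y. \<Phi> s z \<le> \<Phi> s y"
    using continuous_attains_inf[OF compact_X UNIV_not_empty, of "apply_bcontfun (\<Phi> s)"] by auto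
  \<comment> \<open>The minimum of s over the compact space is a positive constant below s. The
    positive map \<open>A\<close> fixes constants, so this constant also lies below
    \<open>A s\<close>, which vanishes at x.\<close>
  have "cone_le Pos (\<Phi> s z *\<^sub>R 1) s"
    using z s(1) scaleR_one_C by (simp add: \<Phi>_order)
  then have "A (s - \<Phi> s z *\<^sub>R 1) \<in> Pos"
    using s(1) scaleR_one_C A_positive subspace_diff[OF subspace_C] by (simp add: cone_le_def)
  then have "cone_le Pos (\<Phi> s z *\<^sub>R 1) (A s)"
    using s(1) scaleR_one_C by (simp add: A_diff A_scaleR_one cone_le_def)
  then have "\<Phi> s z \<le> \<Phi> (A s) x"
    using s(1) scaleR_one_C by (simp add: \<Phi>_order A_in_C)
  with s(3) s_pos[of z] show False by simp
qed

text \<open>Separation of points makes the image point unique; continuity comes from the closed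
  graph in a compact Hausdorff space.\<close>

lemma phase_map_ex1:
  "\<exists>!\<beta>. continuous_on UNIV \<beta> \<and> (\<forall>c\<in>C. \<forall>x. \<Phi> (A c) x = \<Phi> c (\<beta> x))"
proof -
  obtain \<beta> where \<beta>: "\<And>x c. c \<in> C \<Longrightarrow> \<Phi> (A c) x = \<Phi> c (\<beta> x)"
    using phase_point_exists by metis
  have unique: "\<beta> x = y" if "\<And>c. c \<in> C \<Longrightarrow> \<Phi> (A c) x = \<Phi> c y" for x y
    using \<Phi>_separates[of "\<beta> x" y] \<beta> that by metis
  \<comment> \<open>This is the graph of \<beta>, written as an intersection of equality sets of
    continuous real functions so that its closedness is visible.\<close>
  define G where "G = (\<Inter>c\<in>C. {p. \<Phi> (A c) (fst p) = \<Phi> c (snd p)})"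
  have G: "p \<in> G \<longleftrightarrow> snd p = \<beta> (fst p)" for p
    using \<beta> unique[of "fst p" "snd p"] by (auto simp: G_def)
  have cont: "continuous_on UNIV (\<lambda>p. g (fst p))" "continuous_on UNIV (\<lambda>p. g (snd p))"
    for g :: "'x \<Rightarrow>\<^sub>C real"
    by (rule continuous_on_compose2[OF continuous_on_apply_bcontfun[of UNIV g]];
        simp add: continuous_on_fst continuous_on_snd)+
  have "closed G"
    unfolding G_def by (intro closed_INT ballI closed_Collect_eq cont)
  have "compact (UNIV :: ('x \<times> 'x) set)"
    using compact_Times[OF compact_X compact_X] by simp
  have "closed (\<beta> -` S)" if "closed S" for S
  proof -
    \<comment> \<open>The preimage of S is the first projection of this closed subset of a compact
      space, hence compact and closed.\<close>
    have "closed (G \<inter> snd -` S)"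
      using that \<open>closed G\<close> by (intro closed_Int closed_vimage continuous_on_snd continuous_on_id)
    then have "compact (G \<inter> snd -` S)"
      using compact_Int_closed[OF \<open>compact UNIV\<close>] by simp
    then have "closed (fst ` (G \<inter> snd -` S))"
      by (intro compact_imp_closed compact_continuous_image continuous_on_fst continuous_on_id)
    also have "fst ` (G \<inter> snd -` S) = \<beta> -` S"
    proof (intro equalityI subsetI)
      fix x assume "x \<in> \<beta> -` S"
      then have "(x, \<beta> x) \<in> G \<inter> snd -` S" by (simp add: G)
      then show "x \<in> fst ` (G \<inter> snd -` S)" by (rule image_eqI[rotated]) simp
    qed (auto simp: G)
    finally show ?thesis .
  qed
  then have "continuous_on UNIV \<beta>"
    by (simp add: continuous_on_closed_vimage)
  show ?thesis
  proof (rule ex1I[of _ \<beta>])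
    show "continuous_on UNIV \<beta> \<and> (\<forall>c\<in>C. \<forall>x. \<Phi> (A c) x = \<Phi> c (\<beta> x))"
      using \<beta> \<open>continuous_on UNIV \<beta>\<close> by blast
    show "\<gamma> = \<beta>" if "continuous_on UNIV \<gamma> \<and> (\<forall>c\<in>C. \<forall>x. \<Phi> (A c) x = \<Phi> c (\<gamma> x))" for \<gamma>
    proof
      fix x show "\<gamma> x = \<beta> x"
        by (rule unique[symmetric]) (use that in simp)
    qed
  qed
qed

lemma continuous_on_\<alpha>: "continuous_on UNIV \<alpha>"
  and \<Phi>_A: "c \<in> C \<Longrightarrow> \<Phi> (A c) x = \<Phi> c (\<alpha> x)"
  using theI'[OF phase_map_ex1] unfolding phase_map_def by blast+

lemma continuous_on_\<alpha>_funpow: "continuous_on UNIV (\<alpha> ^^ n)"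
proof (induction n)
  case (Suc n)
  then show ?case
    using continuous_on_compose2[OF continuous_on_\<alpha> Suc] by (simp add: comp_def)
qed (simp add: id_def)

text \<open>The covariance relation on \<open>C\<close> passes to uniform limits: composition with
  \<alpha> preserves uniform convergence, and \<open>J\<close> and multiplication by
  \<open>E\<close> are continuous.\<close>

lemma covariance_J:
  assumes cont: "continuous_on UNIV g"
  shows "E * J (Bcontfun g) = J (Bcontfun (\<lambda>x. g (\<alpha> x))) * E"
proof -
  obtain c where c: "\<And>n. c n \<in> C" "(\<lambda>n. \<Phi> (c n)) \<longlonglongrightarrow> Bcontfun g" using dense_sequence by blast
  have "uniform_limit UNIV (\<lambda>n x. \<Phi> (c n) (\<alpha> x)) (\<lambda>x. Bcontfun g (\<alpha> x)) sequentially"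
    using tendsto_bcontfun_uniform_limit[OF c(2)] by (rule uniform_limit_compose') simp
  then have "uniform_limit UNIV (\<lambda>n. apply_bcontfun (\<Phi> (A (c n))))
      (apply_bcontfun (Bcontfun (\<lambda>x. g (\<alpha> x)))) sequentially"
    using \<Phi>_A[OF c(1)] cont continuous_on_compose2[OF cont continuous_on_\<alpha>]
    by (simp add: apply_Bcontfun cong: uniform_limit_cong')
  then have "(\<lambda>n. \<Phi> (A (c n))) \<longlonglongrightarrow> Bcontfun (\<lambda>x. g (\<alpha> x))"
    by (rule uniform_limit_tendsto_bcontfun)
  from tendsto_J[OF this] have "(\<lambda>n. A (c n)) \<longlonglongrightarrow> J (Bcontfun (\<lambda>x. g (\<alpha> x)))"
    using c(1) by (simp add: J_\<Phi> A_in_C)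
  then have "(\<lambda>n. A (c n) * E) \<longlonglongrightarrow> J (Bcontfun (\<lambda>x. g (\<alpha> x))) * E"
    by (intro tendsto_intros)
  moreover have "(\<lambda>n. A (c n) * E) \<longlonglongrightarrow> E * J (Bcontfun g)"
    using tendsto_mult[OF tendsto_const[of E] tendsto_J[OF c(2)]] c(1)
    by (simp add: J_\<Phi> covariance)
  ultimately show ?thesis using LIMSEQ_unique by blast
qed

section \<open>Exponential moments of Birkhoff sums\<close>

definition birkhoff :: "('x \<Rightarrow>\<^sub>C real) \<Rightarrow> nat \<Rightarrow> 'x \<Rightarrow> real" where
  "birkhoff f n x = (\<Sum>i<n. f ((\<alpha> ^^ i) x))"

lemma empirical_eq_birkhoff: "empirical \<alpha> x n f = birkhoff f n x / real n"
  by (simp add: empirical_def birkhoff_def)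

lemma continuous_on_birkhoff: "continuous_on UNIV (birkhoff f n)"
  unfolding birkhoff_def
  by (intro continuous_on_sum continuous_on_compose2[OF _ continuous_on_\<alpha>_funpow, of UNIV]) auto

text \<open>Splits off the first summand, so that the rest appears composed with \<alpha>, the form
  produced by moving \<open>E\<close> past a function.\<close>

lemma birkhoff_Suc: "birkhoff f (Suc n) x = f x + birkhoff f n (\<alpha> x)"
  by (simp add: birkhoff_def sum.lessThan_Suc_shift funpow_swap1 del: sum.lessThan_Suc)

lemma E_phi_power_perturbed:
  "E_phi C \<Phi> E (\<phi> + t *\<^sub>R f) ^ n
    = J (Bcontfun (\<lambda>x. exp (t * birkhoff f n x))) * E_phi C \<Phi> E \<phi> ^ n"
proof (induction n)
  case 0
  then show ?case by (simp add: birkhoff_def J_one)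
next
  case (Suc n)
  define W where "W = E_phi C \<Phi> E \<phi> ^ n"
  define S where "S x = exp (t * birkhoff f n x)" for x
  have S: "continuous_on UNIV S"
    unfolding S_def by (intro continuous_intros continuous_on_birkhoff)
  have S\<alpha>: "continuous_on UNIV (\<lambda>x. S (\<alpha> x))"
    using continuous_on_compose2[OF S continuous_on_\<alpha>] by simp
  have ef: "continuous_on UNIV (\<lambda>x. exp (\<phi> x + t * f x))" "continuous_on UNIV (\<lambda>x. exp (\<phi> x))"
    by (intro continuous_intros continuous_on_apply_bcontfun)+
  have eS: "continuous_on UNIV (\<lambda>x. exp (t * birkhoff f (Suc n) x))"
    by (intro continuous_intros continuous_on_birkhoff)
  have "E_phi C \<Phi> E (\<phi> + t *\<^sub>R f) ^ Suc n
      = J (Bcontfun (\<lambda>x. exp (\<phi> x + t * f x))) * (E * J (Bcontfun S)) * W"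
    unfolding power_Suc Suc.IH
    by (simp add: E_phi_def[of _ _ _ "\<phi> + t *\<^sub>R f"] exp_C_def mult.assoc W_def S_def[abs_def])
  \<comment> \<open>Covariance carries \<open>E\<close> to the right of the Birkhoff factor. The
    exponent \<phi> + t f then combines with the shifted sum into the next Birkhoff sum, leaving
    e^\<phi> next to \<open>E\<close>.\<close>
  also have "\<dots> = J (Bcontfun (\<lambda>x. exp (\<phi> x + t * f x))) * J (Bcontfun (\<lambda>x. S (\<alpha> x))) * E * W"
    by (simp add: covariance_J[OF S] mult.assoc)
  also have "J (Bcontfun (\<lambda>x. exp (\<phi> x + t * f x))) * J (Bcontfun (\<lambda>x. S (\<alpha> x)))
      = J (Bcontfun (\<lambda>x. exp (t * birkhoff f (Suc n) x) * exp (\<phi> x)))"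
    unfolding J_mult[OF ef(1) S\<alpha>, symmetric]
    by (simp add: S_def birkhoff_Suc exp_add[symmetric] algebra_simps)
  also have "\<dots> = J (Bcontfun (\<lambda>x. exp (t * birkhoff f (Suc n) x))) * J (exp_C \<phi>)"
    unfolding J_mult[OF eS ef(2)] exp_C_def ..
  finally show ?case by (simp add: E_phi_def[of _ _ _ \<phi>] W_def mult.assoc)
qed

section \<open>Exponential bounds for deviations of the empirical means\<close>

abbreviation spectral :: "('x \<Rightarrow>\<^sub>C real) \<Rightarrow> real" where
  "spectral \<psi> \<equiv> real_of_ereal (spectral_potential C \<Phi> E \<psi>)"

text \<open>Norms of powers are submultiplicative, so the \<open>lim\<close> defining the spectral
  potential is a genuine limit.\<close>

lemma spectral_tendsto:
  assumes "\<bar>spectral_potential C \<Phi> E \<psi>\<bar> \<noteq> \<infinity>"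
  shows "(\<lambda>n. ln_ext (norm (E_phi C \<Phi> E \<psi> ^ n)) / ereal (real n)) \<longlonglongrightarrow> ereal (spectral \<psi>)"
proof -
  have "convergent (\<lambda>n. ln_ext (norm (E_phi C \<Phi> E \<psi> ^ n)) / ereal (real n))"
    by (intro convergent_ln_ext_submultiplicative) (auto simp: power_add norm_mult_ineq)
  then have "(\<lambda>n. ln_ext (norm (E_phi C \<Phi> E \<psi> ^ n)) / ereal (real n))
      \<longlonglongrightarrow> spectral_potential C \<Phi> E \<psi>"
    unfolding spectral_potential_def by (simp add: convergent_LIMSEQ_iff)
  with assms show ?thesis by (simp add: ereal_real)
qed

text \<open>The factor \<open>\<kappa>\<close> serves both the normalised measures \<open>P n\<close> (\<open>\<kappa> = 1\<close>) and, for an eigen-state,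
  the measure of \<open>\<nu>\<close> itself (\<open>\<kappa> = \<nu> 1\<close>).\<close>

definition tilted :: "('a \<Rightarrow> real) \<Rightarrow> ('x \<Rightarrow>\<^sub>C real) \<Rightarrow> nat \<Rightarrow> real \<Rightarrow> 'x measure \<Rightarrow> bool" where
  "tilted \<nu> \<phi> n \<kappa> N \<longleftrightarrow> sets N = sets borel \<and> finite_measure N \<and>
    (\<forall>g. integral\<^sup>L N (apply_bcontfun g)
      = \<kappa> * (\<nu> (J g * E_phi C \<Phi> E \<phi> ^ n) / \<nu> (E_phi C \<Phi> E \<phi> ^ n)))"

text \<open>A Chernoff bound whose constants are fixed before \<open>n\<close>,
  \<open>\<kappa>\<close> and \<open>N\<close>, so that it covers both the varying measures
  \<open>P n\<close> and the fixed measure of an eigen-state.\<close>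

lemma upper_deviation:
  assumes finite_potential: "\<And>\<psi>. \<bar>spectral_potential C \<Phi> E \<psi>\<bar> \<noteq> \<infinity>"
    and derivative: "((\<lambda>t. spectral (\<phi> + t *\<^sub>R f)) has_real_derivative a) (at 0)"
    and state: "state Pos \<nu>" and sensitive: "sensitive C \<Phi> E \<phi> \<nu>" and "\<epsilon> > 0"
  obtains B c where "c > 0" and "\<forall>\<^sub>F n in sequentially. \<forall>\<kappa>\<ge>0. \<forall>N. tilted \<nu> \<phi> n \<kappa> N \<longrightarrow>
      measure N {x. empirical \<alpha> x n f - a > \<epsilon>} \<le> \<kappa> * B * exp (- c) ^ n"
proof -
  define L where "L t = spectral (\<phi> + t *\<^sub>R f)" for t
  have "((\<lambda>t. (L t - L 0) / t) \<longlongrightarrow> a) (at 0)"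
    using derivative by (simp add: L_def DERIV_def)
  then have "((\<lambda>t. (L t - L 0) / t) \<longlongrightarrow> a) (at_right 0)"
    by (rule filterlim_mono) (auto simp: at_within_le_at)
  then have "\<forall>\<^sub>F t in at_right 0. (L t - L 0) / t < a + \<epsilon> / 2"
    using order_tendstoD(2) \<open>\<epsilon> > 0\<close> by (metis half_gt_zero less_add_same_cancel1)
  then have "\<forall>\<^sub>F t in at_right 0. (L t - L 0) / t < a + \<epsilon> / 2 \<and> t > (0::real)"
    using eventually_at_right_less by (rule eventually_conj)
  \<comment> \<open>One fixed t suffices. Its difference quotient uses up at most half of the margin
    \<epsilon>; the other half produces the decay.\<close>
  then obtain t where t: "(L t - L 0) / t < a + \<epsilon> / 2" "t > 0"
    using eventually_happens' trivial_limit_at_right_real by blast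
  then have Lt: "L t - L 0 \<le> t * (a + \<epsilon> / 2)" by (simp add: field_simps)
  \<comment> \<open>The exponent per step will be at most 2\<delta> - t\<epsilon>/2, where 2\<delta>
    is the error of the two growth rates. With t\<epsilon>/2 = 4\<delta> this leaves
    -2\<delta>.\<close>
  define \<delta> where "\<delta> = t * \<epsilon> / 8"
  have "\<delta> > 0" using t \<open>\<epsilon> > 0\<close> by (simp add: \<delta>_def)
  \<comment> \<open>Continuity of \<nu> turns the growth rate of the norm into an upper bound for
    the numerator of the exponential moment.\<close>
  obtain B where B: "\<And>y. \<bar>\<nu> y\<bar> \<le> norm y * B" "B \<ge> 0"
    using state bounded_linear.nonneg_bounded unfolding state_def by (metis real_norm_def)
  have "\<forall>\<^sub>F n in sequentially. norm (E_phi C \<Phi> E (\<phi> + t *\<^sub>R f) ^ n) \<le> exp (real n * (L t + \<delta>))"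
    unfolding L_def
    by (rule eventually_growth_bounds(1)[OF spectral_tendsto[OF finite_potential] \<open>\<delta> > 0\<close>])
  \<comment> \<open>Sensitivity bounds the denominator from below at the rate
    \<open>L 0\<close>.\<close>
  moreover have "(\<lambda>n. ln_ext (\<nu> (E_phi C \<Phi> E \<phi> ^ n)) / ereal (real n)) \<longlonglongrightarrow> ereal (L 0)"
    using sensitive finite_potential by (simp add: sensitive_def L_def ereal_real)
  note eventually_growth_bounds(2)[OF this \<open>\<delta> > 0\<close>]
  ultimately have "\<forall>\<^sub>F n in sequentially. \<forall>\<kappa>\<ge>0. \<forall>N. tilted \<nu> \<phi> n \<kappa> N \<longrightarrow>
      measure N {x. empirical \<alpha> x n f - a > \<epsilon>} \<le> \<kappa> * B * exp (- (2 * \<delta>)) ^ n"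
    using eventually_gt_at_top[of 0]
  proof eventually_elim
    case (elim n)
    show ?case
    proof (intro allI impI)
      fix \<kappa> :: real and N assume "\<kappa> \<ge> 0" and N: "tilted \<nu> \<phi> n \<kappa> N"
      interpret finite_measure N using N by (simp add: tilted_def)
      have sets_N [measurable_cong]: "sets N = sets borel" using N by (simp add: tilted_def)
      then have space_N: "space N = UNIV" using sets_eq_imp_space_eq[OF sets_N] by simp
      define h where "h x = exp (t * birkhoff f n x)" for x
      have h: "continuous_on UNIV h"
        unfolding h_def by (intro continuous_intros continuous_on_birkhoff)
      then have [measurable]: "h \<in> borel_measurable borel"
        by (rule borel_measurable_continuous_onI)
      have "bounded (range h)"
        using compact_imp_bounded[OF compact_continuous_image[OF h compact_X]] .
      then obtain K where "\<And>x. norm (h x) \<le> K" by (auto simp: bounded_iff)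
      then have h_int: "integrable N h"
        by (intro integrable_const_bound[of _ K]) auto
      \<comment> \<open>The value of h at which the empirical mean equals a + \<epsilon>; it serves
        as the threshold in Markov's inequality.\<close>
      define T where "T = exp (t * (real n * (a + \<epsilon>)))"
      have "{x. empirical \<alpha> x n f - a > \<epsilon>} \<subseteq> {x \<in> space N. h x \<ge> T}"
      proof
        fix x assume "x \<in> {x. empirical \<alpha> x n f - a > \<epsilon>}"
        then have "real n * (a + \<epsilon>) \<le> birkhoff f n x"
          using elim(3) by (simp add: empirical_eq_birkhoff field_simps)
        then have "t * (real n * (a + \<epsilon>)) \<le> t * birkhoff f n x"
          using t(2) by (intro mult_left_mono) auto
        then show "x \<in> {x \<in> space N. h x \<ge> T}" by (simp add: h_def T_def space_N)
      qed
      then have "measure N {x. empirical \<alpha> x n f - a > \<epsilon>} \<le> measure N {x \<in> space N. h x \<ge> T}"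
        by (intro finite_measure_mono) measurable
      also have "\<dots> \<le> (\<integral>x. h x \<partial>N) / T"
        by (rule integral_Markov_inequality_measure[OF h_int sets.empty_sets])
          (auto simp: h_def T_def)
      also have "(\<integral>x. h x \<partial>N) = \<kappa> * (\<nu> (J (Bcontfun h) * E_phi C \<Phi> E \<phi> ^ n) / \<nu> (E_phi C \<Phi> E \<phi> ^ n))"
        using N unfolding tilted_def by (metis apply_Bcontfun[OF h])
      also have "J (Bcontfun h) * E_phi C \<Phi> E \<phi> ^ n = E_phi C \<Phi> E (\<phi> + t *\<^sub>R f) ^ n"
        unfolding E_phi_power_perturbed h_def ..
      also have "\<kappa> * (\<nu> (E_phi C \<Phi> E (\<phi> + t *\<^sub>R f) ^ n) / \<nu> (E_phi C \<Phi> E \<phi> ^ n)) / T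
          \<le> \<kappa> * (exp (real n * (L t + \<delta>)) * B / exp (real n * (L 0 - \<delta>))) / T"
      proof -
        have "\<nu> (E_phi C \<Phi> E (\<phi> + t *\<^sub>R f) ^ n) \<le> exp (real n * (L t + \<delta>)) * B"
          using B(1)[of "E_phi C \<Phi> E (\<phi> + t *\<^sub>R f) ^ n"] mult_right_mono[OF elim(1) B(2)] by linarith
        then show ?thesis
          using elim(2) \<open>\<kappa> \<ge> 0\<close> B(2)
          by (intro divide_right_mono mult_left_mono frac_le) (auto simp: T_def)
      qed
      also have "\<dots> = \<kappa> * B * exp (real n * (L t - L 0 + 2 * \<delta> - t * (a + \<epsilon>)))"
      proof -
        have "exp (real n * (L t - L 0 + 2 * \<delta> - t * (a + \<epsilon>)))
            = exp (real n * (L t + \<delta>)) / exp (real n * (L 0 - \<delta>)) / T"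
          unfolding T_def exp_diff[symmetric] by (simp add: algebra_simps)
        then show ?thesis by simp
      qed
      also have "\<dots> \<le> \<kappa> * B * exp (real n * - (2 * \<delta>))"
      proof -
        have "L t - L 0 + 2 * \<delta> - t * (a + \<epsilon>) \<le> - (2 * \<delta>)"
          using Lt by (simp add: \<delta>_def algebra_simps)
        then have "real n * (L t - L 0 + 2 * \<delta> - t * (a + \<epsilon>)) \<le> real n * - (2 * \<delta>)"
          by (intro mult_left_mono) simp_all
        then show ?thesis
          using \<open>\<kappa> \<ge> 0\<close> B(2) by (intro mult_left_mono) simp_all
      qed
      also have "exp (real n * - (2 * \<delta>)) = exp (- (2 * \<delta>)) ^ n"
        by (rule exp_of_nat_mult)
      finally show "measure N {x. empirical \<alpha> x n f - a > \<epsilon>} \<le> \<kappa> * B * exp (- (2 * \<delta>)) ^ n" .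
    qed
  qed
  then show thesis using that[of "2 * \<delta>" B] \<open>\<delta> > 0\<close> by simp
qed

lemma open_deviation: "open {x. \<bar>empirical \<alpha> x n f - a\<bar> > \<epsilon>}"
  unfolding empirical_eq_birkhoff divide_inverse
  by (intro open_Collect_less continuous_intros continuous_on_birkhoff)

text \<open>The lower tail for f is the upper tail for -f with derivative -a. Both bounds decay
  geometrically, so their sum is summable, as Borel-Cantelli requires.\<close>

lemma deviation:
  assumes finite_potential: "\<And>\<psi>. \<bar>spectral_potential C \<Phi> E \<psi>\<bar> \<noteq> \<infinity>"
    and derivative: "((\<lambda>t. spectral (\<phi> + t *\<^sub>R f)) has_real_derivative a) (at 0)"
    and state: "state Pos \<nu>" and sensitive: "sensitive C \<Phi> E \<phi> \<nu>" and "\<epsilon> > 0"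
  obtains r :: "nat \<Rightarrow> real" where "summable r" and "\<forall>\<^sub>F n in sequentially. \<forall>\<kappa>\<ge>0. \<forall>N. tilted \<nu> \<phi> n \<kappa> N \<longrightarrow>
      measure N {x. \<bar>empirical \<alpha> x n f - a\<bar> > \<epsilon>} \<le> \<kappa> * r n"
proof -
  have "((\<lambda>t. spectral (\<phi> + (- t) *\<^sub>R f)) has_real_derivative - a) (at 0)"
    using DERIV_chain2[of "\<lambda>t. spectral (\<phi> + t *\<^sub>R f)" a uminus 0 "-1"] derivative
    by (simp add: DERIV_minus[of "\<lambda>x. x", simplified])
  then have derivative': "((\<lambda>t. spectral (\<phi> + t *\<^sub>R (- f))) has_real_derivative - a) (at 0)"
    by simp
  obtain B c where c: "c > 0" and upper: "\<forall>\<^sub>F n in sequentially. \<forall>\<kappa>\<ge>0. \<forall>N. tilted \<nu> \<phi> n \<kappa> N \<longrightarrow>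
      measure N {x. empirical \<alpha> x n f - a > \<epsilon>} \<le> \<kappa> * B * exp (- c) ^ n"
    using upper_deviation[OF finite_potential derivative state sensitive \<open>\<epsilon> > 0\<close>] by blast
  obtain B' c' where c': "c' > 0" and lower: "\<forall>\<^sub>F n in sequentially. \<forall>\<kappa>\<ge>0. \<forall>N. tilted \<nu> \<phi> n \<kappa> N \<longrightarrow>
      measure N {x. empirical \<alpha> x n (- f) - - a > \<epsilon>} \<le> \<kappa> * B' * exp (- c') ^ n"
    using upper_deviation[OF finite_potential derivative' state sensitive \<open>\<epsilon> > 0\<close>] by blast
  define r where "r n = B * exp (- c) ^ n + B' * exp (- c') ^ n" for n
  have "summable r"
    unfolding r_def using c c' by (intro summable_add summable_mult summable_geometric) auto
  moreover have "\<forall>\<^sub>F n in sequentially. \<forall>\<kappa>\<ge>0. \<forall>N. tilted \<nu> \<phi> n \<kappa> N \<longrightarrow>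
      measure N {x. \<bar>empirical \<alpha> x n f - a\<bar> > \<epsilon>} \<le> \<kappa> * r n"
    using upper lower
  proof eventually_elim
    case (elim n)
    show ?case
    proof (intro allI impI)
      fix \<kappa> :: real and N assume "\<kappa> \<ge> 0" and N: "tilted \<nu> \<phi> n \<kappa> N"
      interpret finite_measure N using N by (simp add: tilted_def)
      have meas: "{x. empirical \<alpha> x n g - b > \<epsilon>} \<in> sets N" for g b
      proof -
        have "open {x. empirical \<alpha> x n g - b > \<epsilon>}"
          unfolding empirical_eq_birkhoff divide_inverse
          by (intro open_Collect_less continuous_intros continuous_on_birkhoff)
        then show ?thesis using N by (simp add: tilted_def)
      qed
      have "empirical \<alpha> x n (- f) = - empirical \<alpha> x n f" for x
        by (simp add: empirical_def sum_negf)
      then have "{x. \<bar>empirical \<alpha> x n f - a\<bar> > \<epsilon>}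
          = {x. empirical \<alpha> x n f - a > \<epsilon>} \<union> {x. empirical \<alpha> x n (- f) - - a > \<epsilon>}"
        by auto
      then have "measure N {x. \<bar>empirical \<alpha> x n f - a\<bar> > \<epsilon>}
          \<le> measure N {x. empirical \<alpha> x n f - a > \<epsilon>} + measure N {x. empirical \<alpha> x n (- f) - - a > \<epsilon>}"
        using measure_Un_le[OF meas[of f a] meas[of "- f" "- a"]] by simp
      also have "\<dots> \<le> \<kappa> * B * exp (- c) ^ n + \<kappa> * B' * exp (- c') ^ n"
        using elim \<open>\<kappa> \<ge> 0\<close> N by (intro add_mono) blast+
      finally show "measure N {x. \<bar>empirical \<alpha> x n f - a\<bar> > \<epsilon>} \<le> \<kappa> * r n"
        by (simp add: r_def algebra_simps)
    qed
  qed
  ultimately show thesis by (rule that)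
qed

text \<open>The factors are absorbed one at a time from the right, so \<open>b\<close> must stay
  arbitrary in the induction. The powers cancel in the quotient defining \<open>P n\<close>, which
  makes it independent of n.\<close>

lemma eigen_state_power:
  assumes "right_eigen_state C \<Phi> E \<phi> \<nu>"
  shows "\<nu> (b * E_phi C \<Phi> E \<phi> ^ n) = exp (spectral \<phi>) ^ n * \<nu> b"
proof (induction n arbitrary: b)
  case (Suc n)
  have "\<nu> (b * E_phi C \<Phi> E \<phi> ^ Suc n) = \<nu> ((b * E_phi C \<Phi> E \<phi>) * E_phi C \<Phi> E \<phi> ^ n)"
    by (simp add: mult.assoc)
  also have "\<dots> = exp (spectral \<phi>) ^ n * \<nu> (b * E_phi C \<Phi> E \<phi>)" by (rule Suc)
  finally show ?case using assms by (simp add: right_eigen_state_def)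
qed simp

end

section \<open>Almost sure convergence and the two laws of large numbers\<close>

lemma AE_tendsto_of_summable_deviations:
  fixes X :: "nat \<Rightarrow> 'b \<Rightarrow> real"
  assumes "finite_measure M"
    and meas: "\<And>n \<epsilon>. {x. \<bar>X n x - a\<bar> > \<epsilon>} \<in> sets M"
    and summ: "\<And>\<epsilon>. \<epsilon> > 0 \<Longrightarrow> summable (\<lambda>n. measure M {x. \<bar>X n x - a\<bar> > \<epsilon>})"
  shows "AE x in M. (\<lambda>n. X n x) \<longlonglongrightarrow> a"
proof -
  interpret finite_measure M by fact
  \<comment> \<open>Borel-Cantelli at the levels 1/(k+1): countably many levels allow a single
    exceptional null set, and they are cofinal among all positive thresholds.\<close>
  have "AE x in M. \<forall>\<^sub>F n in sequentially. x \<in> space M - {x. \<bar>X n x - a\<bar> > inverse (real (Suc k))}" for k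
    by (intro borel_cantelli_AE1 meas summ) (auto simp: less_top[symmetric])
  then have "AE x in M. \<forall>k. \<forall>\<^sub>F n in sequentially. x \<in> space M - {x. \<bar>X n x - a\<bar> > inverse (real (Suc k))}"
    by (simp add: AE_all_countable)
  then show ?thesis
  proof (rule AE_mp, intro AE_I2 impI)
    fix x assume ev: "\<forall>k. \<forall>\<^sub>F n in sequentially. x \<in> space M - {x. \<bar>X n x - a\<bar> > inverse (real (Suc k))}"
    show "(\<lambda>n. X n x) \<longlonglongrightarrow> a"
    proof (rule tendstoI)
      fix e :: real assume "e > 0"
      then obtain k where k: "inverse (real (Suc k)) < e" using reals_Archimedean by blast
      from ev have "\<forall>\<^sub>F n in sequentially. x \<in> space M - {x. \<bar>X n x - a\<bar> > inverse (real (Suc k))}"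
        by blast
      then show "\<forall>\<^sub>F n in sequentially. dist (X n x) a < e"
        by eventually_elim (use k in \<open>auto simp: dist_real_def\<close>)
    qed
  qed
qed

theorem theorem6p4:
  fixes Pos C :: "'a::{real_normed_algebra_1,banach} set"
    and E :: 'a and A :: "'a \<Rightarrow> 'a"
    and \<Phi> :: "'a \<Rightarrow> ('x::t2_space \<Rightarrow>\<^sub>C real)"
    and \<phi> f :: "'x \<Rightarrow>\<^sub>C real" and a :: real
    and \<nu> :: "'a \<Rightarrow> real"
    and P :: "nat \<Rightarrow> 'x measure" and M :: "'x measure"
  assumes flow: "covariant_positive_flow Pos C E A"
    and phase: "phase_space Pos C \<Phi>"
    and finite_potential: "\<And>\<psi>. \<bar>spectral_potential C \<Phi> E \<psi>\<bar> \<noteq> \<infinity>"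
    and derivative:
      "((\<lambda>t. real_of_ereal (spectral_potential C \<Phi> E (\<phi> + t *\<^sub>R f))) has_real_derivative a) (at 0)"
    and state: "state Pos \<nu>"
    and sensitive: "sensitive C \<Phi> E \<phi> \<nu>"
    and M: "riesz_measure M (\<lambda>g. \<nu> (embed_CX C \<Phi> g))"
    and P: "\<And>n. \<nu> (E_phi C \<Phi> E \<phi> ^ n) > 0 \<Longrightarrow>
      riesz_measure (P n)
        (\<lambda>g. \<nu> (embed_CX C \<Phi> g * E_phi C \<Phi> E \<phi> ^ n) / \<nu> (E_phi C \<Phi> E \<phi> ^ n))"
  shows "(\<forall>\<epsilon>>0. (\<lambda>n. measure (P n)
            {x. \<bar>empirical (phase_map C \<Phi> A) x n f - a\<bar> > \<epsilon>}) \<longlonglongrightarrow> 0)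
       \<and> (right_eigen_state C \<Phi> E \<phi> \<nu> \<longrightarrow>
            (AE x in M. (\<lambda>n. empirical (phase_map C \<Phi> A) x n f) \<longlonglongrightarrow> a))"
proof -
  interpret phased_flow Pos C E A \<Phi>
    using flow phase by (simp add: phased_flow_def)
  define Z where "Z n = \<nu> (E_phi C \<Phi> E \<phi> ^ n)" for n
  have "(\<lambda>n. ln_ext (Z n) / ereal (real n)) \<longlonglongrightarrow> ereal (spectral \<phi>)"
    using sensitive finite_potential by (simp add: sensitive_def Z_def ereal_real)
  from eventually_growth_bounds(2)[OF this zero_less_one]
  \<comment> \<open>The measures \<open>P n\<close> are specified only where this denominator is
    positive; sensitivity guarantees that eventually.\<close>
  have Z: "\<forall>\<^sub>F n in sequentially. Z n > 0"
    by eventually_elim (meson exp_gt_zero less_le_trans)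
  have weak: "(\<lambda>n. measure (P n) {x. \<bar>empirical \<alpha> x n f - a\<bar> > \<epsilon>}) \<longlonglongrightarrow> 0" if eps: "\<epsilon> > 0" for \<epsilon>
  proof -
    obtain r where "summable r" and r: "\<forall>\<^sub>F n in sequentially. \<forall>\<kappa>\<ge>0. \<forall>N. tilted \<nu> \<phi> n \<kappa> N \<longrightarrow>
        measure N {x. \<bar>empirical \<alpha> x n f - a\<bar> > \<epsilon>} \<le> \<kappa> * r n"
      using deviation[OF finite_potential derivative state sensitive eps] by blast
    have bound: "\<forall>\<^sub>F n in sequentially. measure (P n) {x. \<bar>empirical \<alpha> x n f - a\<bar> > \<epsilon>} \<le> r n"
      using r Z
    proof eventually_elim
      case (elim n)
      have "tilted \<nu> \<phi> n 1 (P n)"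
        using P[of n] elim(2) by (simp add: Z_def tilted_def riesz_measure_def regular_borel_def)
      then show ?case using elim(1) by (metis mult_1 zero_le_one)
    qed
    show ?thesis
      by (rule tendsto_sandwich[OF _ bound tendsto_const summable_LIMSEQ_zero[OF \<open>summable r\<close>]]) simp
  qed
  have strong: "AE x in M. (\<lambda>n. empirical \<alpha> x n f) \<longlonglongrightarrow> a" if eigen: "right_eigen_state C \<Phi> E \<phi> \<nu>"
  proof (rule AE_tendsto_of_summable_deviations)
    show "finite_measure M" using M by (simp add: riesz_measure_def regular_borel_def)
    show "{x. \<bar>empirical \<alpha> x n f - a\<bar> > \<epsilon>} \<in> sets M" for n \<epsilon>
      using M open_deviation by (simp add: riesz_measure_def regular_borel_def)
    have Z_eq: "Z n = exp (spectral \<phi>) ^ n * \<nu> 1" for n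
      using eigen_state_power[OF eigen, of 1 n] by (simp add: Z_def)
    obtain n where "Z n > 0" using eventually_happens[OF Z] by auto
    then have "\<nu> 1 > 0" by (simp add: Z_eq zero_less_mult_iff)
    \<comment> \<open>For an eigen-state, \<nu>(g E_\<phi>^n) / \<nu>(E_\<phi>^n) = \<nu>(g) /
      \<nu>(1) for every n. Hence the single measure M satisfies the deviation bounds for all large
      n, with factor \<open>\<nu> 1\<close>.\<close>
    then have tilted: "tilted \<nu> \<phi> n (\<nu> 1) M" for n
      using M Z_eq[of n] eigen_state_power[OF eigen]
      by (simp add: tilted_def riesz_measure_def regular_borel_def Z_def)
    fix \<epsilon> :: real assume "\<epsilon> > 0"
    then obtain r where "summable r" and r: "\<forall>\<^sub>F n in sequentially. \<forall>\<kappa>\<ge>0. \<forall>N. tilted \<nu> \<phi> n \<kappa> N \<longrightarrow>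
        measure N {x. \<bar>empirical \<alpha> x n f - a\<bar> > \<epsilon>} \<le> \<kappa> * r n"
      using deviation[OF finite_potential derivative state sensitive] by blast
    have "\<forall>\<^sub>F n in sequentially. norm (measure M {x. \<bar>empirical \<alpha> x n f - a\<bar> > \<epsilon>}) \<le> \<nu> 1 * r n"
      using r by eventually_elim (use tilted \<open>\<nu> 1 > 0\<close> in auto)
    then show "summable (\<lambda>n. measure M {x. \<bar>empirical \<alpha> x n f - a\<bar> > \<epsilon>})"
      by (rule summable_comparison_test_ev) (intro summable_mult \<open>summable r\<close>)
  qed
  show ?thesis using weak strong by blast
qed

end
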